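(* Let $\mathbb{G}^n=\mathbb{R}^n_\Psi$ be the Gaussian space, with coordinates $(r,\xi)\in\mathbb{R}\times\mathbb{R}^{n-1}$ and weight $\Psi(r,\xi)=\frac{r^2}{2}+\frac{|\xi|^2}{2}$, and let $\bar A(r_1,r_2)=[r_1,r_2]\times\mathbb{R}^{n-1}\subset\mathbb{G}^n$ be a slab, with $A(r_1,r_2)=(r_1,r_2)\times\mathbb{R}^{n-1}$. Let $f:\mathbb{R}\to\mathbb{R}$ be of class $C^2$ with $f''(t)\le0$, let $c_1,c_2\in\mathbb{R}$, and let $u\in C^4(\bar A(r_1,r_2))$ be a solution of $$\begin{cases}\Delta_\Psi u=f(u)&\text{in }A(r_1,r_2)\\ u\equiv c_1&\text{on }\{r_1\}\times\mathbb{R}^{n-1}\\ u\equiv c_2&\text{on }\{r_2\}\times\mathbb{R}^{n-1}.\end{cases}$$ If $$\|u\|_{C^2_{rad}}:=\sup_{A(r_1,r_2)}|u|+\sup_{A(r_1,r_2)}|\partial_ru|+\sup_{A(r_1,r_2)}|\partial_r^2u|<+\infty$$ and $f'(u)\ge-B$ for some constant $B\ge0$ satisfying $$0\le B<\left(\int_{r_1}^{r_2}\frac{\int_{r_1}^se^{-z^2/2}\,dz}{e^{-s^2/2}}\,ds\right)^{-1},$$ then $u$ is symmetric, i.e. $u(r,\xi)=\hat u(r)$ depends only on $r$.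
   Context: The Gaussian space $\mathbb{G}^n$ is $\mathbb{R}^n$ with its flat metric and the measure $e^{-|x|^2/2}dx$; its weighted Laplacian is the Ornstein–Uhlenbeck operator $\Delta_\Psi u=\Delta u-\langle\nabla u,x\rangle$. *)

theory Defs
  imports "HOL-Analysis.Analysis"
begin

text \<open>
  Points of \<open>\<real>\<^sup>n\<close> have type \<^typ>\<open>real ^ 'n\<close>. An arbitrary index \<open>k :: 'n\<close> is singled out:
  \<open>x $ k\<close> is the coordinate \<open>r\<close>, and the remaining components form
  \<open>\<xi> \<in> \<real>\<^sup>n\<^sup>-\<^sup>1\<close> (so \<open>n = 1\<close> is included). Functions on a slab are total functions on
  \<open>\<real>\<^sup>n\<close>; only their values on the closed slab matter.
\<close>

definition slab :: "'n::finite \<Rightarrow> real \<Rightarrow> real \<Rightarrow> (real ^ 'n) set" where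
  "slab k r1 r2 = {x. r1 < x $ k \<and> x $ k < r2}"

definition closed_slab :: "'n::finite \<Rightarrow> real \<Rightarrow> real \<Rightarrow> (real ^ 'n) set" where
  "closed_slab k r1 r2 = {x. r1 \<le> x $ k \<and> x $ k \<le> r2}"

definition partial :: "'n::finite \<Rightarrow> (real ^ 'n \<Rightarrow> real) \<Rightarrow> real ^ 'n \<Rightarrow> real" where
  "partial i u x = deriv (\<lambda>t. u (x + t *\<^sub>R axis i 1)) 0"

definition grad :: "(real ^ 'n::finite \<Rightarrow> real) \<Rightarrow> real ^ 'n \<Rightarrow> real ^ 'n" where
  "grad u x = (\<chi> i. partial i u x)"

definition laplacian :: "(real ^ 'n::finite \<Rightarrow> real) \<Rightarrow> real ^ 'n \<Rightarrow> real" where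
  "laplacian u x = (\<Sum>i\<in>UNIV. partial i (partial i u) x)"

definition weighted_laplacian ::
    "(real ^ 'n::finite \<Rightarrow> real) \<Rightarrow> (real ^ 'n \<Rightarrow> real) \<Rightarrow> real ^ 'n \<Rightarrow> real" where
  "weighted_laplacian \<Psi> u x = laplacian u x - grad u x \<bullet> grad \<Psi> x"

definition gaussian_weight :: "real ^ 'n::finite \<Rightarrow> real" where
  "gaussian_weight x = (norm x)\<^sup>2 / 2"

text \<open>
  \<open>C\<^sup>m\<close> up to the boundary, for an open set \<open>S\<close>: all partial derivatives of order at most \<open>m\<close>
  exist in \<open>S\<close> and extend continuously to \<open>closure S\<close>. In the recursion, \<open>g\<close> is the
  extension of the \<open>i\<close>-th partial derivative; its own derivatives are only taken in \<open>S\<close>.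
\<close>

primrec C_up_to_boundary :: "nat \<Rightarrow> (real ^ 'n::finite) set \<Rightarrow> (real ^ 'n \<Rightarrow> real) \<Rightarrow> bool" where
  "C_up_to_boundary 0 S u \<longleftrightarrow> continuous_on (closure S) u"
| "C_up_to_boundary (Suc m) S u \<longleftrightarrow> continuous_on (closure S) u \<and>
     (\<forall>i. \<exists>g. (\<forall>x\<in>S. ((\<lambda>t. u (x + t *\<^sub>R axis i 1)) has_real_derivative g x) (at 0)) \<and>
              C_up_to_boundary m S g)"

definition C2_real :: "(real \<Rightarrow> real) \<Rightarrow> bool" where
  "C2_real f \<longleftrightarrow> (\<forall>t. f field_differentiable at t) \<and> (\<forall>t. deriv f field_differentiable at t) \<and>
     continuous_on UNIV (deriv (deriv f))"

text \<open>The suprema are taken in the extended nonnegative reals, so the norm may be infinite.\<close>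

definition C2_rad_norm ::
    "'n::finite \<Rightarrow> (real ^ 'n) set \<Rightarrow> (real ^ 'n \<Rightarrow> real) \<Rightarrow> ennreal" where
  "C2_rad_norm k S u =
     (SUP x\<in>S. ennreal \<bar>u x\<bar>) + (SUP x\<in>S. ennreal \<bar>partial k u x\<bar>) +
     (SUP x\<in>S. ennreal \<bar>partial k (partial k u) x\<bar>)"

lemma closure_slab:
  fixes k :: "'n::finite"
  assumes "r1 < r2"
  shows "closure (slab k r1 r2) = closed_slab k r1 r2"
proof -
  have eq: "closed_slab k r1 r2 = {x. x $ k \<ge> r1} \<inter> {x. x $ k \<le> r2}"
    by (auto simp: closed_slab_def)
  have int: "interior (closed_slab k r1 r2) = slab k r1 r2"
    unfolding eq interior_Int
    using interior_halfspace_ge[of "axis k 1 :: real ^ 'n" r1]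
      interior_halfspace_le[of "axis k 1 :: real ^ 'n" r2]
    by (auto simp: slab_def inner_axis' axis_eq_0_iff)
  have "(\<chi> i. (r1 + r2) / 2) \<in> slab k r1 r2"
    using assms by (auto simp: slab_def)
  moreover have "convex (closed_slab k r1 r2)"
    unfolding eq using convex_halfspace_ge[of r1 "axis k 1 :: real ^ 'n"]
      convex_halfspace_le[of "axis k 1 :: real ^ 'n" r2]
    by (intro convex_Int) (simp_all add: inner_axis')
  moreover have "closed (closed_slab k r1 r2)"
    unfolding eq by (intro closed_Int closed_halfspace_component_le_cart closed_halfspace_component_ge_cart)
  ultimately show ?thesis
    using convex_closure_interior[of "closed_slab k r1 r2"] int by auto
qed

lemma grad_gaussian_weight: "grad gaussian_weight x = x"
proof -
  have "partial i gaussian_weight x = x $ i" for i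
  proof -
    have "gaussian_weight (x + t *\<^sub>R axis i 1) = (x \<bullet> x + 2 * t * (x $ i) + t\<^sup>2) / 2" for t
      unfolding gaussian_weight_def power2_norm_eq_inner
      by (simp add: inner_add_left inner_add_right inner_axis inner_axis' power2_eq_square
          algebra_simps)
    moreover have "((\<lambda>t. (x \<bullet> x + 2 * t * (x $ i) + t\<^sup>2) / 2) has_real_derivative x $ i) (at 0)"
      by (auto intro!: derivative_eq_intros)
    ultimately show ?thesis
      unfolding partial_def by (simp only: DERIV_imp_deriv)
  qed
  then show ?thesis by (simp add: grad_def)
qed

lemma weighted_laplacian_gaussian:
  "weighted_laplacian gaussian_weight u x = laplacian u x - grad u x \<bullet> x"
  by (simp add: weighted_laplacian_def grad_gaussian_weight)

end

theory Submission
  imports Defs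
begin

text \<open>
  The proof doubles the variables \<open>\<xi>\<close>. On pairs \<open>(x, y)\<close> with common coordinate \<open>x $ k = y $ k = r\<close>, the
  function \<open>w(r, \<xi>, \<xi>') = u(r, \<xi>) - u(r, \<xi>')\<close> satisfies \<open>\<Delta>\<^sub>\<Psi> w = f (u x) - f (u y)\<close> for the
  Ornstein-Uhlenbeck operator in \<open>(r, \<xi>, \<xi>')\<close>, is bounded, and vanishes for \<open>r = r1\<close> and \<open>r = r2\<close>.
  By concavity of \<open>f\<close>, the right-hand side is at least \<open>-B w\<close> wherever \<open>w > 0\<close>. The bound on \<open>B\<close> provides
  \<open>\<phi>(r) > 0\<close> with \<open>\<phi>'' - r \<phi>' = -1\<close> and \<open>B \<phi> < 1\<close>, a strict supersolution, and the maximum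
  principle applied to \<open>w / \<phi> - \<epsilon> (\<bar>\<xi>\<bar>\<^sup>2 + \<bar>\<xi>'\<bar>\<^sup>2)\<close> yields \<open>w \<le> 0\<close> as \<open>\<epsilon> \<rightarrow> 0\<close>.
\<close>

section \<open>Second-derivative test along coordinate axes\<close>

text \<open>If \<open>D\<close> were positive, \<open>h'\<close>, which vanishes at 0, would be
  positive just to the right of 0, and the mean value theorem would make \<open>h\<close> exceed
  \<open>h 0\<close> there.\<close>

lemma local_max_second_derivative:
  fixes h h' :: "real \<Rightarrow> real"
  assumes "0 < e"
    and h: "\<And>t. \<bar>t\<bar> < e \<Longrightarrow> (h has_real_derivative h' t) (at t)"
    and h': "(h' has_real_derivative D) (at 0)"
    and max: "\<And>t. \<bar>t\<bar> < e \<Longrightarrow> h t \<le> h 0"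
  shows "h' 0 = 0" and "D \<le> 0"
proof -
  show zero: "h' 0 = 0"
    using DERIV_local_max[OF h[of 0] \<open>0 < e\<close>] max \<open>0 < e\<close> by simp
  show "D \<le> 0"
  proof (rule ccontr)
    assume "\<not> D \<le> 0"
    then obtain d where d: "0 < d" "\<And>t. 0 < t \<Longrightarrow> t < d \<Longrightarrow> 0 < h' t"
      using DERIV_pos_inc_right[OF h'] zero by auto
    define s where "s = min d e / 2"
    have s: "0 < s" "s < d" "s < e" using d \<open>0 < e\<close> by (auto simp: s_def)
    obtain z where z: "0 < z" "z < s" "h s - h 0 = (s - 0) * h' z"
      using MVT2[OF s(1), of h h'] h s by auto
    have "0 < s * h' z" using d(2)[of z] z s by simp
    with z max[of s] s show False by simp
  qed
qed

text \<open>\<open>C_up_to_boundary\<close> supplies derivatives at parameter 0, through an unnamed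
  \<open>g\<close>. On the open set \<open>S\<close> this \<open>g\<close> agrees with
  \<open>partial i u\<close>, and shifting the base point gives differentiability along a whole
  segment, as the second-derivative test requires.\<close>

lemma partial_derivatives_along_axis:
  fixes u :: "real ^ 'n::finite \<Rightarrow> real"
  assumes u: "C_up_to_boundary (Suc (Suc m)) S u" and "open S" "x \<in> S"
  obtains e where "0 < e"
    "\<And>t. \<bar>t\<bar> < e \<Longrightarrow> x + t *\<^sub>R axis i 1 \<in> S"
    "\<And>t. \<bar>t\<bar> < e \<Longrightarrow>
      ((\<lambda>t. u (x + t *\<^sub>R axis i 1)) has_real_derivative partial i u (x + t *\<^sub>R axis i 1)) (at t)"
    "((\<lambda>t. partial i u (x + t *\<^sub>R axis i 1)) has_real_derivative partial i (partial i u) x) (at 0)"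
proof -
  obtain g where g: "\<And>x. x \<in> S \<Longrightarrow>
      ((\<lambda>t. u (x + t *\<^sub>R axis i 1)) has_real_derivative g x) (at 0)"
    and Cg: "C_up_to_boundary (Suc m) S g"
    using u by (metis C_up_to_boundary.simps(2))
  obtain G where G: "\<And>x. x \<in> S \<Longrightarrow>
      ((\<lambda>t. g (x + t *\<^sub>R axis i 1)) has_real_derivative G x) (at 0)"
    using Cg by (metis C_up_to_boundary.simps(2))
  have pg: "partial i u y = g y" if "y \<in> S" for y
    using g[OF that] unfolding partial_def by (rule DERIV_imp_deriv)
  obtain e where e: "0 < e" "ball x e \<subseteq> S"
    using \<open>open S\<close> \<open>x \<in> S\<close> open_contains_ball by blast
  have inS: "x + t *\<^sub>R axis i 1 \<in> S" if "\<bar>t\<bar> < e" for t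
    using e(2) that by (auto simp: dist_norm subset_iff)
  have 1: "((\<lambda>t. u (x + t *\<^sub>R axis i 1)) has_real_derivative partial i u (x + t *\<^sub>R axis i 1)) (at t)"
    if "\<bar>t\<bar> < e" for t
  proof -
    have "((\<lambda>s. u ((x + t *\<^sub>R axis i 1) + s *\<^sub>R axis i 1)) has_real_derivative
        partial i u (x + t *\<^sub>R axis i 1)) (at 0)"
      using g[OF inS[OF that]] pg[OF inS[OF that]] by simp
    then show ?thesis
      using DERIV_at_within_shift[of "\<lambda>s. u (x + s *\<^sub>R axis i 1)" _ t 0 UNIV]
      by (simp add: algebra_simps)
  qed
  have near: "eventually (\<lambda>t. t \<in> ball 0 e) (nhds (0::real))"
    using e(1) by (intro eventually_nhds_in_open) auto
  have "eventually (\<lambda>t. partial i u (x + t *\<^sub>R axis i 1) = g (x + t *\<^sub>R axis i 1)) (nhds 0)"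
    using near by eventually_elim (simp add: pg inS)
  then have "((\<lambda>t. partial i u (x + t *\<^sub>R axis i 1)) has_real_derivative G x) (at 0)"
    using G[OF \<open>x \<in> S\<close>] by (subst DERIV_cong_ev[OF refl _ refl])
  then have 2: "((\<lambda>t. partial i u (x + t *\<^sub>R axis i 1)) has_real_derivative
      partial i (partial i u) x) (at 0)"
    unfolding partial_def[of i "partial i u"] using DERIV_imp_deriv by metis
  show thesis using that[OF e(1) inS 1 2] .
qed

text \<open>The one-variable test applies to the combination minus the barrier
  \<open>\<psi>\<close>, on a segment short enough to stay in \<open>S\<close>. The coefficients
  cover both motions needed later: two points moved in parallel (\<open>a = 1\<close>,
  \<open>b = -1\<close>), and one point moved alone, with coefficient 0 on a dummy second
  point.\<close>

lemma partial_max_of_diff: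
  fixes u :: "real ^ 'n::finite \<Rightarrow> real"
  assumes "C_up_to_boundary (Suc (Suc m)) S u" "open S" "x \<in> S" "y \<in> S"
    and "0 < d"
    and psi: "\<And>t. \<bar>t\<bar> < d \<Longrightarrow> (\<psi> has_real_derivative \<psi>' t) (at t)"
    and psi': "(\<psi>' has_real_derivative D) (at 0)"
    and max: "\<And>t. \<bar>t\<bar> < d \<Longrightarrow> x + t *\<^sub>R axis i 1 \<in> S \<Longrightarrow> y + t *\<^sub>R axis i 1 \<in> S \<Longrightarrow>
      a * u (x + t *\<^sub>R axis i 1) + b * u (y + t *\<^sub>R axis i 1) - \<psi> t \<le> a * u x + b * u y - \<psi> 0"
  shows "a * partial i u x + b * partial i u y = \<psi>' 0"
    and "a * partial i (partial i u) x + b * partial i (partial i u) y \<le> D"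
proof -
  obtain e1 where e1: "0 < e1" "\<And>t. \<bar>t\<bar> < e1 \<Longrightarrow> x + t *\<^sub>R axis i 1 \<in> S"
    "\<And>t. \<bar>t\<bar> < e1 \<Longrightarrow>
      ((\<lambda>t. u (x + t *\<^sub>R axis i 1)) has_real_derivative partial i u (x + t *\<^sub>R axis i 1)) (at t)"
    "((\<lambda>t. partial i u (x + t *\<^sub>R axis i 1)) has_real_derivative partial i (partial i u) x) (at 0)"
    using partial_derivatives_along_axis[OF assms(1-3)] by metis
  obtain e2 where e2: "0 < e2" "\<And>t. \<bar>t\<bar> < e2 \<Longrightarrow> y + t *\<^sub>R axis i 1 \<in> S"
    "\<And>t. \<bar>t\<bar> < e2 \<Longrightarrow>
      ((\<lambda>t. u (y + t *\<^sub>R axis i 1)) has_real_derivative partial i u (y + t *\<^sub>R axis i 1)) (at t)"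
    "((\<lambda>t. partial i u (y + t *\<^sub>R axis i 1)) has_real_derivative partial i (partial i u) y) (at 0)"
    using partial_derivatives_along_axis[OF assms(1,2,4)] by metis
  define e where "e = min d (min e1 e2)"
  let ?h = "\<lambda>t. a * u (x + t *\<^sub>R axis i 1) + b * u (y + t *\<^sub>R axis i 1) - \<psi> t"
  let ?h' = "\<lambda>t. a * partial i u (x + t *\<^sub>R axis i 1) + b * partial i u (y + t *\<^sub>R axis i 1) - \<psi>' t"
  let ?D = "a * partial i (partial i u) x + b * partial i (partial i u) y - D"
  have "0 < e" using e1 e2 \<open>0 < d\<close> by (simp add: e_def)
  moreover have "(?h has_real_derivative ?h' t) (at t)" if "\<bar>t\<bar> < e" for t
    using that by (intro DERIV_diff DERIV_add DERIV_cmult e1 e2 psi) (auto simp: e_def)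
  moreover have "(?h' has_real_derivative ?D) (at 0)"
    by (intro DERIV_diff DERIV_add DERIV_cmult e1 e2 psi')
  moreover have "?h t \<le> ?h 0" if "\<bar>t\<bar> < e" for t
    using max[of t] e1(2)[of t] e2(2)[of t] that by (simp add: e_def)
  ultimately have "?h' 0 = 0" "?D \<le> 0"
    using local_max_second_derivative[of e ?h ?h' ?D] by blast+
  then show "a * partial i u x + b * partial i u y = \<psi>' 0"
    "a * partial i (partial i u) x + b * partial i (partial i u) y \<le> D" by simp_all
qed

section \<open>The barrier in the variable \<open>r\<close>\<close>

text \<open>The denominator of \<open>h\<close> has derivative \<open>-s\<close> times itself, so
  \<open>h' = 1 + s * h\<close> and \<open>\<phi>' = - h\<close> solves the equation. Its primitive
  is normalised to decrease to \<open>b\<close> at \<open>r2\<close>; since \<open>B\<close> times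
  the integral of \<open>h\<close> is strictly below 1, there is room for a small
  \<open>b > 0\<close>.\<close>

lemma ornstein_uhlenbeck_supersolution:
  fixes r1 r2 B :: real
  defines "h \<equiv> \<lambda>s. integral {r1..s} (\<lambda>z. exp (- (z\<^sup>2 / 2))) / exp (- (s\<^sup>2 / 2))"
  assumes "r1 < r2" and "0 \<le> B" and B: "B < inverse (integral {r1..r2} h)"
  obtains \<phi> \<phi>' :: "real \<Rightarrow> real" and M b where
    "continuous_on {r1..r2} \<phi>" "0 < b" "0 < M" "B * M < 1"
    "\<And>r. r \<in> {r1..r2} \<Longrightarrow> b \<le> \<phi> r \<and> \<phi> r \<le> M"
    "\<And>r. r1 < r \<Longrightarrow> r < r2 \<Longrightarrow> (\<phi> has_real_derivative \<phi>' r) (at r)"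
    "\<And>r. r1 < r \<Longrightarrow> r < r2 \<Longrightarrow> (\<phi>' has_real_derivative r * \<phi>' r - 1) (at r)"
proof -
  let ?E = "\<lambda>z::real. exp (- (z\<^sup>2 / 2))"
  let ?I = "integral {r1..r2} h"
  have contE: "continuous_on A ?E" for A by (intro continuous_intros) auto
  have intE: "?E integrable_on {r1..r2}" by (intro integrable_continuous_real contE)
  have "continuous_on {r1..r2} (\<lambda>s. integral {r1..s} ?E)"
    by (rule indefinite_integral_continuous_1[OF intE])
  then have conth: "continuous_on {r1..r2} h"
    unfolding h_def by (intro continuous_intros) auto
  have inth: "h integrable_on {r1..r2}" by (intro integrable_continuous_real conth)
  have nonneg: "0 \<le> h s" for s
    unfolding h_def by (intro divide_nonneg_pos Henstock_Kurzweil_Integration.integral_nonneg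
        integrable_continuous_real contE) auto
  have I0: "0 \<le> ?I" by (intro Henstock_Kurzweil_Integration.integral_nonneg inth nonneg)
  \<comment> \<open>Since \<open>inverse 0 = 0\<close>, the case \<open>?I = 0\<close> would give
    \<open>B < 0\<close>.\<close>
  have "0 < ?I" using B \<open>0 \<le> B\<close> I0 by (cases "?I = 0") auto
  then have BI: "B * ?I < 1" using B by (simp add: inverse_eq_divide pos_less_divide_eq)
  \<comment> \<open>This makes \<open>B * b\<close> the slack \<open>1 - B * ?I\<close> times a
    factor below 1; \<open>B + 1\<close> keeps the denominator positive when
    \<open>B = 0\<close>.\<close>
  define b where "b = (1 - B * ?I) / (2 * (B + 1))"
  have b: "0 < b" using BI \<open>0 \<le> B\<close> by (simp add: b_def)
  have "B * b = (1 - B * ?I) * (B / (2 * (B + 1)))" by (simp add: b_def)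
  also have "\<dots> < (1 - B * ?I) * 1"
    using BI \<open>0 \<le> B\<close> by (intro mult_strict_left_mono) auto
  finally have BM: "B * (?I + b) < 1" by (simp add: algebra_simps)
  define \<phi> where "\<phi> r = ?I + b - integral {r1..r} h" for r
  show thesis
  proof
    show "continuous_on {r1..r2} \<phi>"
      unfolding \<phi>_def by (intro continuous_intros indefinite_integral_continuous_1 inth)
    show "0 < b" "0 < ?I + b" "B * (?I + b) < 1" using b I0 BM by auto
    show "b \<le> \<phi> r \<and> \<phi> r \<le> ?I + b" if r: "r \<in> {r1..r2}" for r
    proof -
      have i: "h integrable_on {r1..r}"
        using inth r by (auto intro: integrable_subinterval_real)
      then have "0 \<le> integral {r1..r} h"
        by (intro Henstock_Kurzweil_Integration.integral_nonneg nonneg)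
      moreover have "integral {r1..r} h \<le> ?I"
        using r by (intro integral_subset_le i inth) (auto simp: nonneg)
      ultimately show ?thesis by (simp add: \<phi>_def)
    qed
    fix r assume r: "r1 < r" "r < r2"
    have at: "at r within {r1..r2} = at r" using r by (rule at_within_Icc_at)
    have "((\<lambda>x. integral {r1..x} h) has_real_derivative h r) (at r)"
      using integral_has_real_derivative[OF conth, of r] r at by simp
    then show "(\<phi> has_real_derivative - h r) (at r)"
      unfolding \<phi>_def by (auto intro!: derivative_eq_intros)
    have "((\<lambda>x. integral {r1..x} ?E) has_real_derivative ?E r) (at r)"
      using integral_has_real_derivative[OF contE, of r r1 r2] r at by simp
    then show "((\<lambda>r. - h r) has_real_derivative r * (- h r) - 1) (at r)"
      unfolding h_def by (auto intro!: derivative_eq_intros simp: field_simps power2_eq_square)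
  qed
qed

section \<open>Bounds drawn from the hypotheses on \<open>f\<close> and \<open>u\<close>\<close>

text \<open>The derivative is nonincreasing, so the slope at the mean value point is at least the
  slope at the right end \<open>a\<close>. With \<open>a = u x\<close> and \<open>b = u y\<close>
  this turns \<open>deriv f (u x) \<ge> - B\<close> into a linear lower bound for the difference of
  the right-hand sides.\<close>

lemma concave_tangent_below:
  assumes "C2_real f" and "\<And>t. deriv (deriv f) t \<le> 0" and "b < a"
  shows "deriv f a * (a - b) \<le> f a - f b"
proof -
  have f: "(f has_real_derivative deriv f t) (at t)"
    and f': "(deriv f has_real_derivative deriv (deriv f) t) (at t)" for t
    using assms(1) by (auto simp: C2_real_def DERIV_deriv_iff_field_differentiable)
  obtain z where z: "b < z" "z < a" "f a - f b = (a - b) * deriv f z"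
    using MVT2[OF \<open>b < a\<close>, of f "deriv f"] f by auto
  have "deriv f a \<le> deriv f z"
    using z assms(2) f' by (intro DERIV_nonpos_imp_nonincreasing[of z a "deriv f"]) auto
  then show ?thesis using z \<open>b < a\<close> by (simp add: mult.commute)
qed

lemma C2_rad_norm_finite_imp_bounded:
  assumes "C2_rad_norm k S u < \<infinity>"
  obtains C where "0 \<le> C" "\<And>x. x \<in> S \<Longrightarrow> \<bar>u x\<bar> \<le> C"
proof -
  let ?s = "SUP x\<in>S. ennreal \<bar>u x\<bar>"
  have s: "?s < \<infinity>" using assms by (auto simp: C2_rad_norm_def)
  have "\<bar>u x\<bar> \<le> enn2real ?s" if "x \<in> S" for x
  proof -
    have "ennreal \<bar>u x\<bar> \<le> ?s" using that by (rule SUP_upper)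
    also have "?s = ennreal (enn2real ?s)" using s by simp
    finally show ?thesis by (simp add: ennreal_le_iff)
  qed
  then show thesis using that[of "enn2real ?s"] by simp
qed

section \<open>The transversal penalty, touching points and existence of maxima\<close>

lemma open_slab: "open (slab k r1 r2)"
  unfolding slab_def
  by (intro open_Collect_conj open_halfspace_component_lt_cart open_halfspace_component_gt_cart)

text \<open>This is the squared length of \<xi>, obtained by removing the \<open>r\<close> part from
  the squared norm so that the transversal space needs no type of its own.\<close>

definition transversal_sq :: "'n::finite \<Rightarrow> real ^ 'n \<Rightarrow> real" where
  "transversal_sq k x = (norm x)\<^sup>2 - (x $ k)\<^sup>2"

lemma transversal_sq_nonneg: "0 \<le> transversal_sq k x"
  using power_mono[OF component_le_norm_cart[of x k], of 2] by (simp add: transversal_sq_def)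

lemma transversal_sq_axis:
  "transversal_sq k (x + t *\<^sub>R axis i 1) =
     (if i = k then transversal_sq k x else transversal_sq k x + 2 * t * x $ i + t\<^sup>2)"
proof -
  have "(norm (x + t *\<^sub>R axis i 1))\<^sup>2 = (norm x)\<^sup>2 + 2 * t * x $ i + t\<^sup>2"
    unfolding power2_norm_eq_inner
    by (simp add: inner_add_left inner_add_right inner_axis inner_axis' power2_eq_square
        algebra_simps)
  then show ?thesis by (simp add: transversal_sq_def axis_def power2_eq_square algebra_simps)
qed

lemma bounded_transversal_sq_le:
  fixes k :: "'n::finite"
  shows "bounded {x. x \<in> closed_slab k r1 r2 \<and> transversal_sq k x \<le> R}"
proof (rule boundedI)
  fix x :: "real ^ 'n" assume x: "x \<in> {x. x \<in> closed_slab k r1 r2 \<and> transversal_sq k x \<le> R}"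
  have "\<bar>x $ k\<bar> \<le> \<bar>r1\<bar> + \<bar>r2\<bar>" using x by (auto simp: closed_slab_def)
  then have "(x $ k)\<^sup>2 \<le> (\<bar>r1\<bar> + \<bar>r2\<bar>)\<^sup>2" using power_mono[of "\<bar>x $ k\<bar>" _ 2] by simp
  then have "(norm x)\<^sup>2 \<le> R + (\<bar>r1\<bar> + \<bar>r2\<bar>)\<^sup>2" using x by (simp add: transversal_sq_def)
  then show "norm x \<le> sqrt (R + (\<bar>r1\<bar> + \<bar>r2\<bar>)\<^sup>2)" by (rule real_le_rsqrt)
qed

text \<open>
  An interior maximum of \<open>(u x - u y) / \<phi> - \<epsilon> (\<bar>\<xi>\<bar>\<^sup>2 + \<bar>\<xi>'\<bar>\<^sup>2)\<close> with value \<open>m\<close> is rewritten, after multiplying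
  by \<open>\<phi>\<close>, as a touching point from above; this avoids differentiating the quotient.
\<close>

lemma weighted_laplacian_diff_at_touching_point:
  fixes u :: "real ^ 'n::finite \<Rightarrow> real"
  assumes u: "C_up_to_boundary (Suc (Suc n)) (slab k r1 r2) u"
    and x: "x \<in> slab k r1 r2" and y: "y \<in> slab k r1 r2" and xy: "x $ k = y $ k"
    and phi: "\<And>r. r1 < r \<Longrightarrow> r < r2 \<Longrightarrow> (\<phi> has_real_derivative \<phi>' r) (at r)"
    and phi': "\<And>r. r1 < r \<Longrightarrow> r < r2 \<Longrightarrow> (\<phi>' has_real_derivative r * \<phi>' r - 1) (at r)"
    and pos: "0 \<le> \<epsilon>" "0 \<le> \<phi> (x $ k)"
    and le: "\<And>x y. x \<in> slab k r1 r2 \<Longrightarrow> y \<in> slab k r1 r2 \<Longrightarrow> x $ k = y $ k \<Longrightarrow>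
      u x - u y \<le> \<phi> (x $ k) * (m + \<epsilon> * (transversal_sq k x + transversal_sq k y))"
    and eq: "u x - u y = \<phi> (x $ k) * (m + \<epsilon> * (transversal_sq k x + transversal_sq k y))"
  shows "weighted_laplacian gaussian_weight u x - weighted_laplacian gaussian_weight u y \<le>
    4 * real CARD('n) * \<epsilon> * \<phi> (x $ k) - (m + \<epsilon> * (transversal_sq k x + transversal_sq k y))"
proof -
  let ?S = "slab k r1 r2"
  define r where "r = x $ k"
  have r: "r1 < r" "r < r2" using x by (auto simp: r_def slab_def)
  define N where "N = m + \<epsilon> * (transversal_sq k x + transversal_sq k y)"
  define L where "L i z = partial i (partial i u) z - partial i u z * z $ i" for i z
  have wl: "weighted_laplacian gaussian_weight u z = (\<Sum>i\<in>UNIV. L i z)" for z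
    by (simp add: weighted_laplacian_gaussian laplacian_def grad_def L_def inner_vec_def sum_subtractf)
  have axis_k: "axis i (1::real) $ k = (if i = k then 1 else 0)" for i
    by (simp add: axis_def)
  \<comment> \<open>Moving \<open>x\<close> and \<open>y\<close> together along axis
    \<open>k\<close> leaves the penalty unchanged, so \<open>N * \<phi>\<close> touches the
    difference of the \<open>u\<close> values from above, and the equation for \<phi> gives
    \<open>N * (r * \<phi>' r - 1) - r * N * \<phi>' r = - N\<close>.\<close>
  have Lk: "L k x - L k y \<le> - N"
  proof -
    define d where "d = min (r - r1) (r2 - r)"
    have d: "0 < d" "\<And>t. \<bar>t\<bar> < d \<Longrightarrow> r1 < r + t \<and> r + t < r2" using r by (auto simp: d_def)
    have D1: "((\<lambda>t. N * \<phi> (r + t)) has_real_derivative N * \<phi>' (r + t)) (at t)" if "\<bar>t\<bar> < d" for t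
      using d(2)[OF that] phi[of "r + t"] DERIV_shift[of \<phi> "\<phi>' (r + t)" t r]
      by (intro DERIV_cmult) (simp add: add.commute)
    have D2: "((\<lambda>t. N * \<phi>' (r + t)) has_real_derivative N * (r * \<phi>' r - 1)) (at 0)"
      using r phi'[of r] DERIV_shift[of \<phi>' "r * \<phi>' r - 1" 0 r]
      by (intro DERIV_cmult) (simp add: add.commute)
    have mx: "1 * u (x + t *\<^sub>R axis k 1) + (-1) * u (y + t *\<^sub>R axis k 1) - N * \<phi> (r + t)
        \<le> 1 * u x + (-1) * u y - N * \<phi> (r + 0)"
      if "x + t *\<^sub>R axis k 1 \<in> ?S" "y + t *\<^sub>R axis k 1 \<in> ?S" for t
      using le[OF that] eq xy by (simp add: transversal_sq_axis N_def r_def mult.commute axis_k)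
    have "partial k u x - partial k u y = N * \<phi>' r"
      "partial k (partial k u) x - partial k (partial k u) y \<le> N * (r * \<phi>' r - 1)"
      using partial_max_of_diff[OF u open_slab x y d(1) D1 D2 mx] by simp_all
    moreover have "L k x - L k y = partial k (partial k u) x - partial k (partial k u) y
        - r * (partial k u x - partial k u y)"
      using xy by (simp add: L_def r_def algebra_simps)
    ultimately show ?thesis by (simp add: algebra_simps)
  qed
  have quad: "((\<lambda>t. \<phi> r * \<epsilon> * (2 * t * c + t\<^sup>2)) has_real_derivative \<phi> r * \<epsilon> * (2 * c + 2 * t)) (at t)"
    "((\<lambda>t. \<phi> r * \<epsilon> * (2 * c + 2 * t)) has_real_derivative \<phi> r * \<epsilon> * 2) (at 0)" for c t
    by (auto intro!: derivative_eq_intros simp: algebra_simps)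
  \<comment> \<open>Moving \<open>x\<close> alone in a transversal direction freezes
    \<open>\<phi> r\<close>, and the barrier is the quadratic change of the penalty. The first-order
    condition makes the drift contribute
    \<open>- 2 * \<phi> r * \<epsilon> * (x $ i)\<^sup>2\<close>, which is dropped by its
    sign.\<close>
  have Lx: "L i x \<le> 2 * (\<phi> r * \<epsilon>)" if "i \<noteq> k" for i
  proof -
    have mx: "1 * u (x + t *\<^sub>R axis i 1) + 0 * u (x + t *\<^sub>R axis i 1) - \<phi> r * \<epsilon> * (2 * t * x $ i + t\<^sup>2)
        \<le> 1 * u x + 0 * u x - \<phi> r * \<epsilon> * (2 * 0 * x $ i + 0\<^sup>2)" if "x + t *\<^sub>R axis i 1 \<in> ?S" for t
      using le[OF that y] eq xy \<open>i \<noteq> k\<close>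
      by (simp add: transversal_sq_axis r_def axis_k algebra_simps)
    have "partial i u x = \<phi> r * \<epsilon> * (2 * x $ i)" "partial i (partial i u) x \<le> \<phi> r * \<epsilon> * 2"
      using partial_max_of_diff[OF u open_slab x x zero_less_one quad mx] by simp_all
    then have "L i x \<le> \<phi> r * \<epsilon> * 2 - \<phi> r * \<epsilon> * (2 * (x $ i)\<^sup>2)"
      by (simp add: L_def power2_eq_square algebra_simps)
    also have "\<dots> \<le> 2 * (\<phi> r * \<epsilon>)" using pos by (simp add: r_def)
    finally show ?thesis .
  qed
  \<comment> \<open>Here \<open>- u\<close> is maximal along the motion of \<open>y\<close>, and the
    drift again has the favourable sign.\<close>
  have Ly: "- L i y \<le> 2 * (\<phi> r * \<epsilon>)" if "i \<noteq> k" for i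
  proof -
    have mx: "(-1) * u (y + t *\<^sub>R axis i 1) + 0 * u (y + t *\<^sub>R axis i 1) - \<phi> r * \<epsilon> * (2 * t * y $ i + t\<^sup>2)
        \<le> (-1) * u y + 0 * u y - \<phi> r * \<epsilon> * (2 * 0 * y $ i + 0\<^sup>2)" if "y + t *\<^sub>R axis i 1 \<in> ?S" for t
      using le[OF x that] eq xy \<open>i \<noteq> k\<close>
      by (simp add: transversal_sq_axis r_def axis_k algebra_simps)
    have "- partial i u y = \<phi> r * \<epsilon> * (2 * y $ i)" "- partial i (partial i u) y \<le> \<phi> r * \<epsilon> * 2"
      using partial_max_of_diff[OF u open_slab y y zero_less_one quad mx] by simp_all
    moreover have "- L i y = - partial i (partial i u) y - (- partial i u y) * y $ i"
      by (simp add: L_def)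
    ultimately have "- L i y \<le> \<phi> r * \<epsilon> * 2 - \<phi> r * \<epsilon> * (2 * (y $ i)\<^sup>2)"
      by (simp only:) (simp add: power2_eq_square algebra_simps)
    also have "\<dots> \<le> 2 * (\<phi> r * \<epsilon>)" using pos by (simp add: r_def)
    finally show ?thesis .
  qed
  have "(\<Sum>i\<in>UNIV. L i x - L i y) = (L k x - L k y) + (\<Sum>i\<in>UNIV - {k}. L i x - L i y)"
    by (rule sum.remove) auto
  also have "\<dots> \<le> - N + (\<Sum>i\<in>UNIV - {k}. 4 * (\<phi> r * \<epsilon>))"
    using Lx Ly by (intro add_mono Lk sum_mono) fastforce
  \<comment> \<open>The number of transversal directions, \<open>CARD('n) - 1\<close>, is rounded up
    to \<open>CARD('n)\<close>.\<close>
  also have "\<dots> \<le> - N + 4 * real CARD('n) * \<epsilon> * \<phi> r"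
  proof -
    have "real (card (UNIV - {k})) * (4 * (\<phi> r * \<epsilon>)) \<le> real CARD('n) * (4 * (\<phi> r * \<epsilon>))"
      using pos by (intro mult_right_mono of_nat_mono card_mono) (auto simp: r_def)
    then show ?thesis by (simp add: algebra_simps)
  qed
  finally show ?thesis by (simp add: wl sum_subtractf N_def r_def)
qed

text \<open>The set \<open>K\<close> is unbounded when there are transversal directions, but the
  penalty confines all points with \<open>q\<close> at least \<open>q p0\<close> to a compact part
  of it, where continuity yields a maximum.\<close>

lemma attains_sup_coercive:
  fixes k :: "'n::finite" and r1 r2 :: real and q :: "(real ^ 'n) \<times> (real ^ 'n) \<Rightarrow> real"
  defines "K \<equiv> {p. fst p \<in> closed_slab k r1 r2 \<and> snd p \<in> closed_slab k r1 r2 \<and> fst p $ k = snd p $ k}"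
  assumes cont: "continuous_on K q" and "0 < \<epsilon>"
    and coercive: "\<And>p. p \<in> K \<Longrightarrow> q p \<le> C - \<epsilon> * (transversal_sq k (fst p) + transversal_sq k (snd p))"
    and p0: "p0 \<in> K"
  obtains p where "p \<in> K" "\<And>p'. p' \<in> K \<Longrightarrow> q p' \<le> q p"
proof -
  \<comment> \<open>Any \<open>p\<close> in \<open>K\<close> with \<open>q p \<ge> q p0\<close> has
    total transversal square at most this value.\<close>
  define R where "R = (C - q p0) / \<epsilon>"
  define A where "A = {x. x \<in> closed_slab k r1 r2 \<and> transversal_sq k x \<le> R}"
  have "closed A"
    unfolding A_def closed_slab_def mem_Collect_eq transversal_sq_def
    by (intro closed_Collect_conj closed_halfspace_component_ge_cart
        closed_halfspace_component_le_cart closed_Collect_le continuous_intros)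
  then have "compact A"
    using bounded_transversal_sq_le[of k r1 r2 R] by (simp add: A_def compact_eq_bounded_closed)
  moreover have "closed {p :: (real ^ 'n) \<times> (real ^ 'n). fst p $ k = snd p $ k}"
    by (intro closed_Collect_eq continuous_intros)
  ultimately have cpt: "compact (A \<times> A \<inter> {p. fst p $ k = snd p $ k})"
    by (intro compact_Int_closed compact_Times)
  have sub: "A \<times> A \<inter> {p. fst p $ k = snd p $ k} \<subseteq> K" by (auto simp: A_def K_def)
  have inA: "p \<in> A \<times> A \<inter> {p. fst p $ k = snd p $ k}" if "p \<in> K" "q p0 \<le> q p" for p
  proof -
    have "\<epsilon> * (transversal_sq k (fst p) + transversal_sq k (snd p)) \<le> C - q p0"
      using coercive[OF that(1)] that(2) by simp
    then have "transversal_sq k (fst p) + transversal_sq k (snd p) \<le> R"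
      using \<open>0 < \<epsilon>\<close> by (simp add: R_def pos_le_divide_eq mult.commute)
    then show ?thesis
      using that(1) transversal_sq_nonneg[of k "fst p"] transversal_sq_nonneg[of k "snd p"]
      by (cases p) (auto simp: A_def K_def)
  qed
  then obtain p where p: "p \<in> A \<times> A \<inter> {p. fst p $ k = snd p $ k}"
    "\<And>p'. p' \<in> A \<times> A \<inter> {p. fst p $ k = snd p $ k} \<Longrightarrow> q p' \<le> q p"
    using continuous_attains_sup[OF cpt, of q] p0 continuous_on_subset[OF cont sub] by blast
  have "q p' \<le> q p" if "p' \<in> K" for p'
    using p(2)[OF inA[OF that]] p(2)[OF inA[OF p0]] by fastforce
  then show thesis using that p(1) sub by blast
qed

section \<open>The maximum principle in the doubled variables\<close>

theorem corollary6p8: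
  fixes k :: "'n::finite"
    and r1 r2 c1 c2 B :: real
    and f :: "real \<Rightarrow> real"
    and u :: "real ^ 'n \<Rightarrow> real"
  assumes "r1 < r2"
    and "C2_real f"
    and "\<And>t. deriv (deriv f) t \<le> 0"
    and "C_up_to_boundary 4 (slab k r1 r2) u"
    and "\<And>x. x \<in> slab k r1 r2 \<Longrightarrow> weighted_laplacian gaussian_weight u x = f (u x)"
    and "\<And>x. x $ k = r1 \<Longrightarrow> u x = c1"
    and "\<And>x. x $ k = r2 \<Longrightarrow> u x = c2"
    and "C2_rad_norm k (slab k r1 r2) u < \<infinity>"
    and "\<And>x. x \<in> slab k r1 r2 \<Longrightarrow> deriv f (u x) \<ge> - B"
    and "0 \<le> B"
    and "B < inverse (integral {r1..r2}
           (\<lambda>s. integral {r1..s} (\<lambda>z. exp (- (z\<^sup>2 / 2))) / exp (- (s\<^sup>2 / 2))))"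
  shows "\<exists>u_hat :: real \<Rightarrow> real. \<forall>x \<in> closed_slab k r1 r2. u x = u_hat (x $ k)"
proof -
  let ?S = "slab k r1 r2" and ?cS = "closed_slab k r1 r2" and ?P = "transversal_sq k"
  obtain \<phi> \<phi>' M b where contphi: "continuous_on {r1..r2} \<phi>" and b: "0 < b" and M: "0 < M" "B * M < 1"
    and bM: "\<And>r. r \<in> {r1..r2} \<Longrightarrow> b \<le> \<phi> r \<and> \<phi> r \<le> M"
    and phi: "\<And>r. r1 < r \<Longrightarrow> r < r2 \<Longrightarrow> (\<phi> has_real_derivative \<phi>' r) (at r)"
    and phi': "\<And>r. r1 < r \<Longrightarrow> r < r2 \<Longrightarrow> (\<phi>' has_real_derivative r * \<phi>' r - 1) (at r)"
    using ornstein_uhlenbeck_supersolution[OF assms(1,10,11)] by metis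
  have u2: "C_up_to_boundary (Suc (Suc 2)) ?S u" using assms(4) by (simp add: eval_nat_numeral)
  have contu: "continuous_on ?cS u"
    using u2 closure_slab[OF assms(1), of k] by (metis C_up_to_boundary.simps(2))
  have cases_cS: "x \<in> ?S \<or> x $ k = r1 \<or> x $ k = r2" if "x \<in> ?cS" for x
    using that by (auto simp: closed_slab_def slab_def)
  obtain C0 where C0: "0 \<le> C0" "\<And>x. x \<in> ?S \<Longrightarrow> \<bar>u x\<bar> \<le> C0"
    using C2_rad_norm_finite_imp_bounded[OF assms(8)] by metis
  \<comment> \<open>The norm controls \<open>u\<close> on the open slab; adding the boundary values
    extends the bound to the closed slab.\<close>
  define C where "C = C0 + \<bar>c1\<bar> + \<bar>c2\<bar>"
  have C: "0 \<le> C" "\<And>x. x \<in> ?cS \<Longrightarrow> \<bar>u x\<bar> \<le> C"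
    using C0 cases_cS assms(6,7) unfolding C_def by fastforce+
  define K where "K = {p. fst p \<in> ?cS \<and> snd p \<in> ?cS \<and> fst p $ k = snd p $ k}"
  \<comment> \<open>A lower bound for \<open>1 - B * \<phi> r\<close> that is uniform in
    \<open>r\<close>: the strictness of the supersolution.\<close>
  define \<delta> where "\<delta> = 1 - B * M"
  have "0 < \<delta>" using M by (simp add: \<delta>_def)
  define Q where "Q \<epsilon> p = (u (fst p) - u (snd p)) / \<phi> (fst p $ k) - \<epsilon> * (?P (fst p) + ?P (snd p))" for \<epsilon> p
  \<comment> \<open>The bound is linear in \<epsilon> with a constant independent of
    \<open>p0\<close>, so it disappears in the limit.\<close>
  have max_le: "Q \<epsilon> p0 \<le> 4 * real CARD('n) * \<epsilon> * M / \<delta>" if p0: "p0 \<in> K" and "0 < \<epsilon>" for p0 \<epsilon>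
  proof -
    have phi_pos: "b \<le> \<phi> (fst p $ k)" "\<phi> (fst p $ k) \<le> M" if "p \<in> K" for p
      using bM[of "fst p $ k"] that by (auto simp: K_def closed_slab_def)
    have contQ: "continuous_on K (Q \<epsilon>)"
      unfolding Q_def transversal_sq_def
    proof (intro continuous_intros)
      show "continuous_on K (\<lambda>p. u (fst p))" "continuous_on K (\<lambda>p. u (snd p))"
        by (rule continuous_on_compose2[OF contu]; auto simp: K_def intro!: continuous_intros)+
      show "continuous_on K (\<lambda>p. \<phi> (fst p $ k))"
        by (rule continuous_on_compose2[OF contphi]) (auto simp: K_def closed_slab_def intro!: continuous_intros)
      show "\<forall>p\<in>K. \<phi> (fst p $ k) \<noteq> 0" using phi_pos b by fastforce
    qed
    have coercive: "Q \<epsilon> p \<le> 2 * C / b - \<epsilon> * (?P (fst p) + ?P (snd p))" if "p \<in> K" for p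
    proof -
      have "u (fst p) - u (snd p) \<le> 2 * C"
        using C(2)[of "fst p"] C(2)[of "snd p"] that by (auto simp: K_def)
      then have "(u (fst p) - u (snd p)) / \<phi> (fst p $ k) \<le> 2 * C / b"
        using phi_pos[OF that] b C(1) by (intro frac_le) auto
      then show ?thesis by (simp add: Q_def)
    qed
    obtain p where p: "p \<in> K" "\<And>p'. p' \<in> K \<Longrightarrow> Q \<epsilon> p' \<le> Q \<epsilon> p"
      using attains_sup_coercive[of k r1 r2 "Q \<epsilon>" \<epsilon> "2 * C / b" p0] contQ coercive p0 \<open>0 < \<epsilon>\<close>
      unfolding K_def by blast
    define m where "m = Q \<epsilon> p"
    obtain x y where xy: "p = (x, y)" by (cases p)
    have K: "x \<in> ?cS" "y \<in> ?cS" "x $ k = y $ k" using p(1) by (auto simp: K_def xy)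
    have bound: "0 \<le> 4 * real CARD('n) * \<epsilon> * M / \<delta>" using \<open>0 < \<epsilon>\<close> M \<open>0 < \<delta>\<close> by simp
    have "m \<le> 4 * real CARD('n) * \<epsilon> * M / \<delta>"
    proof (cases "0 < m")
      case False
      then show ?thesis using bound by simp
    next
      case True
      have Px: "0 \<le> ?P x + ?P y" by (simp add: transversal_sq_nonneg)
      \<comment> \<open>With equal values only the nonpositive penalty term would remain, against
        \<open>0 < m\<close>. On a boundary face both values would be \<open>c1\<close> or both
        \<open>c2\<close>, so the maximum lies in the open slab.\<close>
      have "u x \<noteq> u y"
      proof
        assume "u x = u y"
        then have "m = - (\<epsilon> * (?P x + ?P y))" by (simp add: m_def Q_def xy)
        moreover have "0 \<le> \<epsilon> * (?P x + ?P y)" using Px \<open>0 < \<epsilon>\<close> by simp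
        ultimately show False using True by linarith
      qed
      then have S: "x \<in> ?S" "y \<in> ?S"
        using cases_cS[OF K(1)] cases_cS[OF K(2)] K(3) assms(6,7) by (auto simp: slab_def)
      define r where "r = x $ k"
      define N where "N = m + \<epsilon> * (?P x + ?P y)"
      have r: "0 < \<phi> r" "\<phi> r \<le> M" using phi_pos[OF p(1)] b by (auto simp: xy r_def)
      have mN: "m \<le> N" using Px \<open>0 < \<epsilon>\<close> by (simp add: N_def)
      have eq: "u x - u y = \<phi> r * N" using r by (simp add: N_def m_def Q_def xy r_def)
      have le: "u x' - u y' \<le> \<phi> (x' $ k) * (m + \<epsilon> * (?P x' + ?P y'))"
        if "x' \<in> ?S" "y' \<in> ?S" "x' $ k = y' $ k" for x' y'
      proof -
        have "(x', y') \<in> K" using that by (auto simp: K_def slab_def closed_slab_def)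
        then have "(u x' - u y') / \<phi> (x' $ k) \<le> m + \<epsilon> * (?P x' + ?P y')" "0 < \<phi> (x' $ k)"
          using p(2)[of "(x', y')"] phi_pos[of "(x', y')"] b by (auto simp: m_def Q_def)
        then show ?thesis by (simp add: pos_divide_le_eq mult.commute)
      qed
      have gap: "0 < u x - u y" using eq r True mN by simp
      \<comment> \<open>The bound on \<open>f'\<close>, concavity, the equation at both points and
        the touching estimate are chained; the result is an inequality for \<open>N\<close>
        alone.\<close>
      have "- B * (u x - u y) \<le> deriv f (u x) * (u x - u y)"
        using assms(9)[OF S(1)] gap by (intro mult_right_mono) auto
      also have "\<dots> \<le> f (u x) - f (u y)"
        using concave_tangent_below[OF assms(2,3)] gap by simp
      also have "\<dots> \<le> 4 * real CARD('n) * \<epsilon> * \<phi> r - N"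
        unfolding r_def N_def assms(5)[OF S(1), symmetric] assms(5)[OF S(2), symmetric]
      proof (rule weighted_laplacian_diff_at_touching_point[OF u2 S K(3) phi phi' _ _ le])
        show "0 \<le> \<epsilon>" "0 \<le> \<phi> (x $ k)" using \<open>0 < \<epsilon>\<close> r by (simp_all add: r_def)
        show "u x - u y = \<phi> (x $ k) * (m + \<epsilon> * (?P x + ?P y))"
          using eq by (simp add: r_def N_def)
      qed
      finally have "- B * (\<phi> r * N) \<le> 4 * real CARD('n) * \<epsilon> * \<phi> r - N"
        unfolding eq .
      then have "(1 - B * \<phi> r) * N \<le> 4 * real CARD('n) * \<epsilon> * \<phi> r"
        by (simp add: left_diff_distrib mult.assoc)
      \<comment> \<open>Both factors on the left are smaller:
        \<open>B * \<phi> r \<le> B * M\<close> and \<open>m \<le> N\<close>.\<close>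
      moreover have "\<delta> * m \<le> (1 - B * \<phi> r) * N"
        using mult_left_mono[OF r(2) assms(10)] mN True \<open>0 < \<delta>\<close>
        by (intro mult_mono) (auto simp: \<delta>_def)
      moreover have "4 * real CARD('n) * \<epsilon> * \<phi> r \<le> 4 * real CARD('n) * \<epsilon> * M"
        using r \<open>0 < \<epsilon>\<close> by (intro mult_left_mono) auto
      ultimately have "\<delta> * m \<le> 4 * real CARD('n) * \<epsilon> * M" by linarith
      then show ?thesis using \<open>0 < \<delta>\<close> by (simp add: pos_le_divide_eq mult.commute)
    qed
    then show ?thesis using p(2)[OF p0] by (simp add: m_def)
  qed
  have le: "u x \<le> u y" if xy: "x \<in> ?cS" "y \<in> ?cS" "x $ k = y $ k" for x y
  proof -
    have "(x, y) \<in> K" using xy by (simp add: K_def)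
    \<comment> \<open>For a fixed pair, moving the penalty to the right leaves \<epsilon> times this
      constant, which tends to 0.\<close>
    define c where "c = 4 * real CARD('n) * M / \<delta> + (?P x + ?P y)"
    have "(u x - u y) / \<phi> (x $ k) \<le> \<epsilon> * c" if "0 < \<epsilon>" for \<epsilon>
      using max_le[OF \<open>(x, y) \<in> K\<close> that] by (simp add: Q_def c_def algebra_simps)
    moreover have "((\<lambda>\<epsilon>. \<epsilon> * c) \<longlongrightarrow> 0 * c) (at_right 0)" by (intro tendsto_intros)
    ultimately have "(u x - u y) / \<phi> (x $ k) \<le> 0 * c"
      by (intro tendsto_lowerbound[where F = "at_right 0"]) (auto simp: eventually_at_filter)
    moreover have "0 < \<phi> (x $ k)" using bM[of "x $ k"] xy b by (auto simp: closed_slab_def)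
    ultimately show ?thesis by (simp add: divide_le_0_iff)
  qed
  \<comment> \<open>The profile is read off on the line where \<xi> vanishes; exchanging the two
    points turns the inequality into equality.\<close>
  have "u x = u (axis k (x $ k))" if "x \<in> ?cS" for x
    using that le[of x "axis k (x $ k)"] le[of "axis k (x $ k)" x]
    by (simp add: closed_slab_def axis_def)
  then show ?thesis by (intro exI[of _ "\<lambda>r. u (axis k r)"]) blast
qed

end
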